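(* Let $T\in\mathcal{L}(\mathcal{H})$. If there is a complex number $z_0$ such that $\dim\ker(T-z_0)\ge 2$ (in particular, if $T\in\mathcal{B}_n(\Omega)$ for some connected open set $\Omega\subset\mathbb{C}$ and some $n\ge 2$), then $T$ is not a backward shift on any Markushevich basis of $\mathcal{H}$.
   Context: $\mathcal{H}$ is a separable, infinite dimensional complex Hilbert space with inner product $(\cdot,\cdot)$, $\mathcal{L}(\mathcal{H})$ is the algebra of bounded linear operators on $\mathcal{H}$, and $\bigvee$ denotes closed linear span. For a connected open set $\Omega\subset\mathbb{C}$ and a positive integer $n$, $\mathcal{B}_n(\Omega)$ is the set of $T\in\mathcal{L}(\mathcal{H})$ such that: (1) $\Omega\subset\sigma(T)$; (2) $\mathrm{ran}(T-z)=\mathcal{H}$ for all $z\in\Omega$; (3) $\bigvee_{z\in\Omega}\ker(T-z)=\mathcal{H}$; (4) $\dim\ker(T-z)=n$ for all $z\in\Omega$. A sequence $\{f_k\}_{k=0}^\infty$ in $\mathcal{H}$ is a Markushevich basis of $\mathcal{H}$ if it is complete, i.e. $\bigvee_{k\ge 0}\{f_k\}=\mathcal{H}$, and there is a sequence $\{g_k\}_{k=0}^\infty$ in $\mathcal{H}$ with $(f_i,g_j)=\delta_{ij}$ for all $i,j\ge 0$ which is total, i.e. $\{x\in\mathcal{H}:(x,g_k)=0\ \forall k\ge 0\}=\{0\}$. $T$ is a backward shift on $\{f_k\}_{k=0}^\infty$ if $Tf_0=0$ and $Tf_k=f_{k-1}$ for $k\ge 1$. *)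

theory Defs
  imports "HOL-Analysis.Analysis" "HOL-Library.Extended_Nat"
begin

text \<open>
  Complex Hilbert spaces, layered over the real inner product spaces of the library, so that
  norm, topology and completeness are the library's. The inner product \<open>cinner\<close> is linear in its
  first argument. Positive definiteness follows from \<open>inner_eq_Re_cinner\<close> and \<open>real_inner\<close>.
\<close>

class complex_vector = real_vector +
  fixes scaleC :: "complex \<Rightarrow> 'a \<Rightarrow> 'a"  (infixr "*\<^sub>C" 75)
  assumes scaleC_add_right: "a *\<^sub>C (x + y) = a *\<^sub>C x + a *\<^sub>C y"
    and scaleC_add_left: "(a + b) *\<^sub>C x = a *\<^sub>C x + b *\<^sub>C x"
    and scaleC_scaleC: "a *\<^sub>C b *\<^sub>C x = (a * b) *\<^sub>C x"
    and scaleR_scaleC: "r *\<^sub>R x = complex_of_real r *\<^sub>C x"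

class complex_inner = complex_vector + real_inner +
  fixes cinner :: "'a \<Rightarrow> 'a \<Rightarrow> complex"
  assumes cinner_commute: "cinner x y = cnj (cinner y x)"
    and cinner_add_left: "cinner (x + y) z = cinner x z + cinner y z"
    and cinner_scaleC_left: "cinner (a *\<^sub>C x) y = a * cinner x y"
    and inner_eq_Re_cinner: "inner x y = Re (cinner x y)"

class complex_hilbert_space = complex_inner + complete_space

global_interpretation complex_vector: vector_space "scaleC :: complex \<Rightarrow> 'a \<Rightarrow> 'a::complex_vector"
  defines cspan = "complex_vector.span"
    and csubspace = "complex_vector.subspace"
    and cdependent = "complex_vector.dependent"
proof
  fix x :: 'a
  show "1 *\<^sub>C x = x"
    using scaleR_scaleC [of 1 x] by simp
qed (simp_all add: scaleC_add_right scaleC_add_left scaleC_scaleC)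

abbreviation cindependent :: "'a::complex_vector set \<Rightarrow> bool"
  where "cindependent S \<equiv> \<not> cdependent S"

text \<open>
  The dimension of a complex subspace, with value \<open>\<infinity>\<close> for infinite-dimensional subspaces; the
  library's \<open>dim\<close> is \<open>0\<close> for those.
\<close>

definition cdimension :: "'a::complex_vector set \<Rightarrow> enat"
  where "cdimension S = (SUP B\<in>{B. B \<subseteq> S \<and> finite B \<and> cindependent B}. enat (card B))"

lemma cdimension_eq_card_basis:
  assumes "finite B" "cindependent B"
  shows "cdimension (cspan B) = enat (card B)"
  unfolding cdimension_def
proof (rule antisym)
  show "(SUP B'\<in>{B'. B' \<subseteq> cspan B \<and> finite B' \<and> cindependent B'}. enat (card B')) \<le> enat (card B)"
  proof (rule SUP_least)
    fix B' assume "B' \<in> {B'. B' \<subseteq> cspan B \<and> finite B' \<and> cindependent B'}"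
    then show "enat (card B') \<le> enat (card B)"
      using complex_vector.independent_span_bound [OF assms(1), of B'] by simp
  qed
  show "enat (card B) \<le> (SUP B'\<in>{B'. B' \<subseteq> cspan B \<and> finite B' \<and> cindependent B'}. enat (card B'))"
    using assms complex_vector.span_superset [of B] by (intro SUP_upper) simp
qed

lemma cdimension_infinite_basis:
  assumes "infinite B" "cindependent B"
  shows "cdimension (cspan B) = \<infinity>"
proof (rule ccontr)
  assume "cdimension (cspan B) \<noteq> \<infinity>"
  then obtain n where n: "cdimension (cspan B) = enat n" by auto
  obtain B' where B': "B' \<subseteq> B" "finite B'" "card B' = Suc n"
    using infinite_arbitrarily_large [OF assms(1)] by metis
  have "enat (card B') \<le> cdimension (cspan B)"
    unfolding cdimension_def
    using B' complex_vector.independent_mono [OF assms(2) B'(1)] complex_vector.span_superset [of B]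
    by (intro SUP_upper) auto
  with n B'(3) show False by simp
qed

definition closed_cspan :: "'a::complex_inner set \<Rightarrow> 'a set"
  where "closed_cspan S = closure (cspan S)"

definition separable_infinite_dimensional :: "'a::complex_inner itself \<Rightarrow> bool"
  where "separable_infinite_dimensional _ \<longleftrightarrow>
    separable_space (euclidean :: 'a topology) \<and> cdimension (UNIV :: 'a set) = \<infinity>"

definition bounded_operators :: "('a::complex_inner \<Rightarrow> 'a) set"
  where "bounded_operators = {T. bounded_linear T \<and> (\<forall>a x. T (a *\<^sub>C x) = a *\<^sub>C T x)}"

definition shifted :: "('a::complex_vector \<Rightarrow> 'a) \<Rightarrow> complex \<Rightarrow> 'a \<Rightarrow> 'a"
  where "shifted T z = (\<lambda>x. T x - z *\<^sub>C x)"

definition null_space :: "('a::zero \<Rightarrow> 'a) \<Rightarrow> 'a set"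
  where "null_space A = {x. A x = 0}"

definition spectrum :: "('a::complex_inner \<Rightarrow> 'a) \<Rightarrow> complex set"
  where "spectrum T = {z. \<not> (\<exists>S\<in>bounded_operators. S \<circ> shifted T z = id \<and> shifted T z \<circ> S = id)}"

text \<open>
  The Cowen--Douglas class \<open>B\<^sub>n(\<Omega>)\<close>. That \<open>\<Omega>\<close> is open and connected and that \<open>n\<close> is positive
  is not part of the definition and has to be assumed separately.
\<close>

definition cowen_douglas :: "nat \<Rightarrow> complex set \<Rightarrow> ('a::complex_hilbert_space \<Rightarrow> 'a) set"
  where "cowen_douglas n \<Omega> = {T \<in> bounded_operators.
    \<Omega> \<subseteq> spectrum T \<and>
    (\<forall>z\<in>\<Omega>. range (shifted T z) = UNIV) \<and>
    closed_cspan (\<Union>z\<in>\<Omega>. null_space (shifted T z)) = UNIV \<and>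
    (\<forall>z\<in>\<Omega>. cdimension (null_space (shifted T z)) = enat n)}"

definition markushevich_basis :: "(nat \<Rightarrow> 'a::complex_hilbert_space) \<Rightarrow> bool"
  where "markushevich_basis f \<longleftrightarrow>
    closed_cspan (range f) = UNIV \<and>
    (\<exists>g :: nat \<Rightarrow> 'a.
      (\<forall>i j. cinner (f i) (g j) = (if i = j then 1 else 0)) \<and>
      {x. \<forall>k. cinner x (g k) = 0} = {0})"

definition backward_shift_on :: "('a::zero \<Rightarrow> 'a) \<Rightarrow> (nat \<Rightarrow> 'a) \<Rightarrow> bool"
  where "backward_shift_on T f \<longleftrightarrow> T (f 0) = 0 \<and> (\<forall>k\<ge>1. T (f k) = f (k - 1))"

end

theory Submission
  imports Defs
begin

text \<open>
  Let \<open>g\<close> be biorthogonal to the Markushevich basis \<open>f\<close>. Since \<open>T\<close> shifts \<open>f\<close> backwards, the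
  coefficient functionals satisfy \<open>(T x, g\<^sub>k) = (x, g\<^sub>k\<^sub>+\<^sub>1)\<close> on the span of \<open>f\<close>, hence everywhere by
  density and continuity. An eigenvector \<open>T x = z x\<close> thus has coefficients
  \<open>(x, g\<^sub>k) = z\<^sup>k (x, g\<^sub>0)\<close>, and by totality of \<open>g\<close> it is determined by the single number
  \<open>(x, g\<^sub>0)\<close>. So every eigenspace has dimension at most one.
\<close>

lemma cinner_scaleC_right: "cinner x (a *\<^sub>C y) = cnj a * cinner x y"
  by (metis cinner_commute cinner_scaleC_left complex_cnj_cnj complex_cnj_mult)

lemma cinner_zero_left: "cinner 0 y = 0"
  using cinner_add_left [of 0 0 y] by simp

lemma cinner_diff_left: "cinner (x - y) z = cinner x z - cinner y z"
  using cinner_add_left [of "x - y" y z] by simp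

text \<open>Since \<open>cinner\<close> is conjugate-linear in its second argument, the real part of
  \<open>cinner x (\<i> *\<^sub>C y)\<close> is the imaginary part of \<open>cinner x y\<close>.
  Continuity of \<open>cinner\<close> thereby reduces to that of the real inner product.\<close>

lemma cinner_eq_Complex: "cinner x y = Complex (inner x y) (inner x (\<i> *\<^sub>C y))"
  by (rule complex_eqI) (simp_all add: inner_eq_Re_cinner cinner_scaleC_right)

lemma continuous_on_cinner_left [continuous_intros]:
  assumes "continuous_on S h"
  shows "continuous_on S (\<lambda>x. cinner (h x) y)"
  unfolding cinner_eq_Complex Complex_eq by (intro continuous_intros assms)

lemma closed_cspan_minimal:
  assumes "S \<subseteq> V" "csubspace V" "closed V"
  shows "closed_cspan S \<subseteq> V"
  unfolding closed_cspan_def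
  using complex_vector.span_minimal [OF assms(1,2)] assms(3) by (rule closure_minimal)

text \<open>If every finite independent subset of \<open>S\<close> had at most \<open>n\<close>
  elements, the supremum defining \<open>cdimension S\<close> would be at most
  \<open>n\<close>.\<close>

lemma cdimension_ge_obtains:
  assumes "cdimension S \<ge> enat (Suc n)"
  obtains B where "B \<subseteq> S" "finite B" "cindependent B" "card B \<ge> Suc n"
proof (rule ccontr)
  assume "\<not> thesis"
  then have "cdimension S \<le> enat n"
    unfolding cdimension_def using that by (intro SUP_least) (force simp: not_less_eq_eq)
  also have "\<dots> < enat (Suc n)" by simp
  finally show False using assms by simp
qed

lemma backward_shift_coefficient:
  assumes T: "T \<in> bounded_operators"
    and shift: "backward_shift_on T f"
    and complete: "closed_cspan (range f) = UNIV"
    and biorth: "\<And>i j. cinner (f i) (g j) = (if i = j then 1 else 0)"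
  shows "cinner (T x) (g k) = cinner x (g (Suc k))"
proof -
  define V where "V = {x. cinner (T x) (g k) = cinner x (g (Suc k))}"
  have lin: "bounded_linear T" and scale: "\<And>a x. T (a *\<^sub>C x) = a *\<^sub>C T x"
    using T by (auto simp: bounded_operators_def)
  interpret T: bounded_linear T by fact
  have "T (f i) = (if i = 0 then 0 else f (i - 1))" for i
    using shift by (cases i) (auto simp: backward_shift_on_def)
  \<comment> \<open>For \<open>i = 0\<close> both sides vanish, as \<open>f 0\<close> is orthogonal
    to \<open>g (Suc k)\<close>; for positive \<open>i\<close> both equal 1 exactly when
    \<open>i = Suc k\<close>.\<close>
  then have "range f \<subseteq> V"
    by (auto simp: V_def biorth cinner_zero_left)
  moreover have "csubspace V"
    by (rule complex_vector.subspaceI)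
      (auto simp: V_def T.zero T.add scale cinner_zero_left cinner_add_left cinner_scaleC_left)
  moreover have "closed V"
    unfolding V_def
    by (intro closed_Collect_eq continuous_intros linear_continuous_on lin)
  ultimately have "closed_cspan (range f) \<subseteq> V"
    by (rule closed_cspan_minimal)
  with complete show ?thesis by (auto simp: V_def)
qed

lemma backward_shift_eigenspace:
  assumes T: "T \<in> bounded_operators"
    and M: "markushevich_basis f"
    and shift: "backward_shift_on T f"
  shows "\<not> cdimension (null_space (shifted T z)) \<ge> 2"
proof
  assume "cdimension (null_space (shifted T z)) \<ge> 2"
  then have "cdimension (null_space (shifted T z)) \<ge> enat (Suc 1)"
    by (simp add: numeral_eq_enat eval_nat_numeral)
  then obtain B where B: "B \<subseteq> null_space (shifted T z)" "cindependent B" "card B \<ge> Suc 1"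
    by (rule cdimension_ge_obtains)
  obtain g where complete: "closed_cspan (range f) = UNIV"
    and biorth: "\<And>i j. cinner (f i) (g j) = (if i = j then 1 else 0)"
    and total: "{x. \<forall>k. cinner x (g k) = 0} = {0}"
    using M by (auto simp: markushevich_basis_def)
  have scale: "T (a *\<^sub>C x) = a *\<^sub>C T x" and diff: "T (x - y) = T x - T y" for a x y
    using T by (auto simp: bounded_operators_def bounded_linear.linear linear_diff)
  have zero: "x = 0" if x: "T x = z *\<^sub>C x" "cinner x (g 0) = 0" for x
  proof -
    have "cinner x (g k) = 0" for k
    proof (induction k)
      case (Suc k)
      have "cinner x (g (Suc k)) = cinner (T x) (g k)"
        by (rule backward_shift_coefficient [OF T shift complete biorth, symmetric])
      with Suc x(1) show ?case by (simp add: cinner_scaleC_left)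
    qed (fact x(2))
    then show ?thesis using total by blast
  qed
  \<comment> \<open>An infinite \<open>B\<close> would have \<open>card B = 0\<close>, so the
    cardinality bound also forces \<open>B\<close> to be finite.\<close>
  obtain x y where xy: "x \<in> B" "y \<in> B" "x \<noteq> y"
    using B(3) card_le_Suc0_iff_eq [of B] by (cases "finite B") force+
  have eigen: "T u = z *\<^sub>C u" if "u \<in> B" for u
    using B(1) that by (auto simp: null_space_def shifted_def)
  define a b where "a = cinner x (g 0)" and "b = cinner y (g 0)"
  \<comment> \<open>The weights are chosen so that the coefficient at \<open>g 0\<close> is
    \<open>b * a - a * b = 0\<close>, while the combination still satisfies the eigenvector equation
    for \<open>z\<close>.\<close>
  have "b *\<^sub>C x - a *\<^sub>C y = 0"
    by (rule zero)
      (simp_all add: diff scale eigen xy cinner_diff_left cinner_scaleC_left a_def b_def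
        scaleC_scaleC mult.commute complex_vector.scale_right_diff_distrib)
  \<comment> \<open>Otherwise \<open>x\<close> itself would be zero, but an independent set does not
    contain zero.\<close>
  moreover have "a \<noteq> 0"
    using zero [OF eigen [OF xy(1)]] complex_vector.dependent_zero B(2) xy(1)
    by (auto simp: a_def)
  ultimately have "y = (b / a) *\<^sub>C x"
    by (metis complex_vector.scale_scale divide_inverse_commute eq_iff_diff_eq_0
        complex_vector.scale_one left_inverse)
  then have "y \<in> cspan (B - {y})"
    using xy by (auto intro: complex_vector.span_scale complex_vector.span_base)
  with B(2) xy(2) show False by (auto simp: complex_vector.dependent_def)
qed

theorem theorem1p3:
  fixes T :: "'a::complex_hilbert_space \<Rightarrow> 'a"
  assumes "separable_infinite_dimensional TYPE('a)"
    and "T \<in> bounded_operators"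
  shows "((\<exists>z\<^sub>0. cdimension (null_space (shifted T z\<^sub>0)) \<ge> 2)
            \<longrightarrow> \<not> (\<exists>f. markushevich_basis f \<and> backward_shift_on T f)) \<and>
         ((\<exists>\<Omega> n. open \<Omega> \<and> connected \<Omega> \<and> n \<ge> 2 \<and> T \<in> cowen_douglas n \<Omega>)
            \<longrightarrow> \<not> (\<exists>f. markushevich_basis f \<and> backward_shift_on T f))"
proof (rule conjI)
  show eigen: "(\<exists>z\<^sub>0. cdimension (null_space (shifted T z\<^sub>0)) \<ge> 2)
      \<longrightarrow> \<not> (\<exists>f. markushevich_basis f \<and> backward_shift_on T f)"
    using backward_shift_eigenspace [OF assms(2)] by blast
  show "(\<exists>\<Omega> n. open \<Omega> \<and> connected \<Omega> \<and> n \<ge> 2 \<and> T \<in> cowen_douglas n \<Omega>)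
      \<longrightarrow> \<not> (\<exists>f. markushevich_basis f \<and> backward_shift_on T f)"
  proof
    assume "\<exists>\<Omega> n. open \<Omega> \<and> connected \<Omega> \<and> n \<ge> 2 \<and> T \<in> cowen_douglas n \<Omega>"
    then obtain \<Omega> n where n: "n \<ge> 2" and CD: "T \<in> cowen_douglas n \<Omega>" by blast
    \<comment> \<open>The empty set counts as connected, so it has to be excluded by the dimension of the space.\<close>
    have "\<Omega> \<noteq> {}"
    proof
      assume "\<Omega> = {}"
      with CD have "closure (cspan {}) = (UNIV :: 'a set)"
        by (simp add: cowen_douglas_def closed_cspan_def)
      \<comment> \<open>The span of the empty set is \<open>{0}\<close>, which is already
        closed.\<close>
      then have "(UNIV :: 'a set) = cspan {}" by simp
      moreover have "cdimension (cspan ({} :: 'a set)) = enat 0"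
        using cdimension_eq_card_basis [of "{} :: 'a set"] complex_vector.independent_empty by simp
      ultimately show False
        using assms(1) by (simp add: separable_infinite_dimensional_def)
    qed
    then obtain z where "z \<in> \<Omega>" by blast
    with CD have "cdimension (null_space (shifted T z)) = enat n"
      by (simp add: cowen_douglas_def)
    with n have "cdimension (null_space (shifted T z)) \<ge> 2"
      by (simp add: numeral_eq_enat)
    with eigen show "\<not> (\<exists>f. markushevich_basis f \<and> backward_shift_on T f)" by blast
  qed
qed

end
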